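(* Let $n\ge 1$, $0<p<1$, and let $\Phi\in L^1_{loc}(\mathbb{R}^n\setminus\{0\})$. Let $X$ be a translation invariant (quasi-)Banach space (of functions or distributions on $\mathbb{R}^n$) such that $C_c^\infty(\mathbb{R}^n)\subset X$, and suppose there is a constant $C>0$ such that $\|g\|_{L^p(\mathbb{R}^n)}\le C\|g\|_X$ for all measurable functions $g\in X$. Then $$H_\Phi \text{ is bounded on } X \iff H_\Phi=0.$$
   Context: Functions are complex-valued. $L^1_{loc}(\mathbb{R}^n\setminus\{0\})$ is the set of measurable functions integrable on every compact subset of $\mathbb{R}^n\setminus\{0\}$. The Hausdorff operator is $$H_\Phi f(x)=\int_{\mathbb{R}^n}\Phi(y)\,f\!\left(\frac{x}{|y|}\right)dy .$$ For $f\in C_c^\infty(\mathbb{R}^n\setminus\{0\})$ (smooth, with compact support not containing the origin) this integral converges absolutely for every $x\in\mathbb{R}^n$ and defines a measurable function. The space $X$ is a quasi-Banach space (Banach spaces included) which is a vector space either of measurable functions on $\mathbb{R}^n$ (modulo equality a.e.) or of distributions on $\mathbb{R}^n$. In the latter case, a measurable function is said to belong to $X$ if it is locally integrable on $\mathbb{R}^n$ and the distribution it defines belongs to $X$. Translation invariant means: for every $f\in X$ and $y\in\mathbb{R}^n$, $T_yf\in X$ and $\|T_yf\|_X=\|f\|_X$, where $T_yf(x)=f(x-y)$. As usual $\|g\|_{L^p}=(\int|g|^p)^{1/p}$. "$H_\Phi$ is bounded on $X$" means: there is a constant $C'$ such that for every $f\in C_c^\infty(\mathbb{R}^n\setminus\{0\})$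 one has $H_\Phi f\in X$ and $\|H_\Phi f\|_X\le C'\|f\|_X$. "$H_\Phi=0$" means $H_\Phi f=0$ for every $f\in C_c^\infty(\mathbb{R}^n\setminus\{0\})$. *)

theory Defs
  imports "HOL-Analysis.Analysis"
begin

section \<open>Smooth functions and test functions\<close>

text \<open>Iterated partial derivatives: for basis vectors \<open>v\<^sub>1, \<dots>, v\<^sub>k\<close>,
  \<open>partials [v\<^sub>1, \<dots>, v\<^sub>k] f\<close> differentiates first in direction \<open>v\<^sub>1\<close>, last in direction
  \<open>v\<^sub>k\<close>. Derivatives are real derivatives of complex-valued functions.\<close>

primrec partials :: "'a::euclidean_space list \<Rightarrow> ('a \<Rightarrow> complex) \<Rightarrow> 'a \<Rightarrow> complex" where
  "partials [] f = f"
| "partials (v # vs) f = partials vs (\<lambda>x. frechet_derivative f (at x) v)"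

definition smooth :: "('a::euclidean_space \<Rightarrow> complex) \<Rightarrow> bool" where
  "smooth f \<longleftrightarrow> (\<forall>vs\<in>lists Basis. \<forall>x. partials vs f differentiable (at x))"

definition supp :: "('a::topological_space \<Rightarrow> complex) \<Rightarrow> 'a set" where
  "supp f = closure {x. f x \<noteq> 0}"

text \<open>\<open>C\<^sub>c\<^sup>\<infinity>(\<Omega>)\<close> for open \<open>\<Omega>\<close>; its members are extended by zero to the whole space.\<close>

definition test_fun :: "'a::euclidean_space set \<Rightarrow> ('a \<Rightarrow> complex) set" where
  "test_fun \<Omega> = {\<phi>. smooth \<phi> \<and> compact (supp \<phi>) \<and> supp \<phi> \<subseteq> \<Omega>}"


section \<open>Local integrability and $L^p$ quasi-norms\<close>

text \<open>\<open>L\<^sup>1\<^sub>l\<^sub>o\<^sub>c(\<Omega>)\<close>. Functions are total; this is used only with \<open>\<Omega>\<close> of full measure, where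
  measurability on \<open>\<Omega>\<close> and on the whole space agree.\<close>

definition L1_loc :: "'a::euclidean_space set \<Rightarrow> ('a \<Rightarrow> complex) set" where
  "L1_loc \<Omega> = {f \<in> borel_measurable lebesgue.
     \<forall>K. compact K \<and> K \<subseteq> \<Omega> \<longrightarrow> set_integrable lebesgue K f}"

definition Lp_norm :: "real \<Rightarrow> ('a::euclidean_space \<Rightarrow> complex) \<Rightarrow> ennreal" where
  "Lp_norm p f =
    (let I = \<integral>\<^sup>+x. ennreal (norm (f x) powr p) \<partial>lebesgue
     in if I = \<infinity> then \<infinity> else ennreal (enn2real I powr (1 / p)))"


section \<open>Distributions\<close>

text \<open>Distributions are represented by functionals that vanish outside the space of test
  functions, so that equality of distributions is equality in HOL. The continuity condition is the
  usual seminorm estimate; summing over lists of basis vectors instead of multi-indices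
  only repeats terms, since partial derivatives commute.\<close>

definition distribution :: "(('a::euclidean_space \<Rightarrow> complex) \<Rightarrow> complex) \<Rightarrow> bool" where
  "distribution u \<longleftrightarrow>
     (\<forall>\<phi>. \<phi> \<notin> test_fun UNIV \<longrightarrow> u \<phi> = 0) \<and>
     (\<forall>\<phi>\<in>test_fun UNIV. \<forall>\<psi>\<in>test_fun UNIV. u (\<lambda>x. \<phi> x + \<psi> x) = u \<phi> + u \<psi>) \<and>
     (\<forall>c. \<forall>\<phi>\<in>test_fun UNIV. u (\<lambda>x. c * \<phi> x) = c * u \<phi>) \<and>
     (\<forall>K. compact K \<longrightarrow> (\<exists>C N. \<forall>\<phi>\<in>test_fun UNIV. supp \<phi> \<subseteq> K \<longrightarrow>
        norm (u \<phi>) \<le> C * (\<Sum>vs | vs \<in> lists Basis \<and> length vs \<le> N. SUP x. norm (partials vs \<phi> x))))"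

definition distribution_of ::
    "('a::euclidean_space \<Rightarrow> complex) \<Rightarrow> ('a \<Rightarrow> complex) \<Rightarrow> complex" where
  "distribution_of g \<phi> = (if \<phi> \<in> test_fun UNIV then LINT x|lebesgue. g x * \<phi> x else 0)"

definition translate :: "'a::euclidean_space \<Rightarrow> ('a \<Rightarrow> complex) \<Rightarrow> 'a \<Rightarrow> complex" where
  "translate y f x = f (x - y)"

text \<open>Translation of distributions, dual to translation of functions:
  \<open>distribution_of (translate y g) = translate_dist y (distribution_of g)\<close> for locally
  integrable \<open>g\<close>.\<close>

definition translate_dist ::
    "'a::euclidean_space \<Rightarrow> (('a \<Rightarrow> complex) \<Rightarrow> complex) \<Rightarrow> ('a \<Rightarrow> complex) \<Rightarrow> complex" where
  "translate_dist y u \<phi> = u (translate (- y) \<phi>)"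


section \<open>Quasi-Banach spaces of functions or distributions\<close>

text \<open>\<open>quasi_banach Z X N\<close>: the complex vector space \<open>X/Z\<close> is a quasi-Banach space under the
  quasi-norm induced by \<open>N\<close>. Elements are complex-valued maps with pointwise operations; this covers
  functions on \<open>\<real>\<^sup>n\<close> modulo null functions as well as distributions (where \<open>Z\<close> is trivial).
  As a quasi-norm only satisfies the triangle inequality up to a constant, invariance of \<open>N\<close>
  under \<open>Z\<close> has to be required separately.\<close>

definition quasi_banach ::
    "('b \<Rightarrow> complex) set \<Rightarrow> ('b \<Rightarrow> complex) set \<Rightarrow> (('b \<Rightarrow> complex) \<Rightarrow> real) \<Rightarrow> bool" where
  "quasi_banach Z X N \<longleftrightarrow>
     Z \<subseteq> X \<and> (\<lambda>_. 0) \<in> X \<and>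
     (\<forall>u\<in>X. \<forall>v\<in>X. (\<lambda>t. u t + v t) \<in> X) \<and>
     (\<forall>c. \<forall>u\<in>X. (\<lambda>t. c * u t) \<in> X) \<and>
     (\<forall>u\<in>X. \<forall>v\<in>X. (\<lambda>t. u t - v t) \<in> Z \<longrightarrow> N u = N v) \<and>
     (\<forall>u\<in>X. 0 \<le> N u) \<and>
     (\<forall>u\<in>X. N u = 0 \<longleftrightarrow> u \<in> Z) \<and>
     (\<forall>c. \<forall>u\<in>X. N (\<lambda>t. c * u t) = norm c * N u) \<and>
     (\<exists>K. \<forall>u\<in>X. \<forall>v\<in>X. N (\<lambda>t. u t + v t) \<le> K * (N u + N v)) \<and>
     (\<forall>s. (\<forall>k::nat. s k \<in> X) \<and>
          (\<forall>e>0. \<exists>M. \<forall>j\<ge>M. \<forall>k\<ge>M. N (\<lambda>t. s j t - s k t) < e) \<longrightarrow>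
          (\<exists>u\<in>X. (\<lambda>k. N (\<lambda>t. s k t - u t)) \<longlonglongrightarrow> 0))"

text \<open>A space with its quasi-norm, consisting either of measurable functions (given by all their
  representatives) or of distributions.\<close>

datatype 'a fd_space =
    Fun_Space "('a \<Rightarrow> complex) set" "('a \<Rightarrow> complex) \<Rightarrow> real"
  | Dist_Space "(('a \<Rightarrow> complex) \<Rightarrow> complex) set" "(('a \<Rightarrow> complex) \<Rightarrow> complex) \<Rightarrow> real"

primrec quasi_banach_space :: "'a::euclidean_space fd_space \<Rightarrow> bool" where
  "quasi_banach_space (Fun_Space X N) \<longleftrightarrow>
     X \<subseteq> borel_measurable lebesgue \<and>
     quasi_banach {f \<in> borel_measurable lebesgue. AE x in lebesgue. f x = 0} X N"
| "quasi_banach_space (Dist_Space X N) \<longleftrightarrow>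
     (\<forall>u\<in>X. distribution u) \<and> quasi_banach {\<lambda>_. 0} X N"

primrec translation_invariant :: "'a::euclidean_space fd_space \<Rightarrow> bool" where
  "translation_invariant (Fun_Space X N) \<longleftrightarrow>
     (\<forall>f\<in>X. \<forall>y. translate y f \<in> X \<and> N (translate y f) = N f)"
| "translation_invariant (Dist_Space X N) \<longleftrightarrow>
     (\<forall>u\<in>X. \<forall>y. translate_dist y u \<in> X \<and> N (translate_dist y u) = N u)"

text \<open>The measurable functions belonging to the space, and their quasi-norm.\<close>

primrec funs_of :: "'a::euclidean_space fd_space \<Rightarrow> ('a \<Rightarrow> complex) set" where
  "funs_of (Fun_Space X N) = X"
| "funs_of (Dist_Space X N) = {g \<in> L1_loc UNIV. distribution_of g \<in> X}"

primrec fnorm :: "'a::euclidean_space fd_space \<Rightarrow> ('a \<Rightarrow> complex) \<Rightarrow> real" where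
  "fnorm (Fun_Space X N) g = N g"
| "fnorm (Dist_Space X N) g = N (distribution_of g)"


section \<open>Hausdorff operators\<close>

definition hausdorff_op ::
    "('a::euclidean_space \<Rightarrow> complex) \<Rightarrow> ('a \<Rightarrow> complex) \<Rightarrow> 'a \<Rightarrow> complex" where
  "hausdorff_op \<Phi> f x = (LINT y|lebesgue. \<Phi> y * f (x /\<^sub>R norm y))"

definition hausdorff_bounded_on ::
    "('a::euclidean_space \<Rightarrow> complex) \<Rightarrow> 'a fd_space \<Rightarrow> bool" where
  "hausdorff_bounded_on \<Phi> X \<longleftrightarrow>
     (\<exists>C. \<forall>f\<in>test_fun (- {0}).
        hausdorff_op \<Phi> f \<in> funs_of X \<and> fnorm X (hausdorff_op \<Phi> f) \<le> C * fnorm X f)"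

text \<open>\<open>hausdorff_op \<Phi> f\<close> is a pointwise defined function, so its vanishing is required everywhere.
  (For locally integrable \<open>\<Phi>\<close> it is continuous off the origin and zero at the origin, so vanishing
  almost everywhere is the same.)\<close>

definition hausdorff_zero :: "('a::euclidean_space \<Rightarrow> complex) \<Rightarrow> bool" where
  "hausdorff_zero \<Phi> \<longleftrightarrow> (\<forall>f\<in>test_fun (- {0}). \<forall>x. hausdorff_op \<Phi> f x = 0)"

end

theory Submission
  imports Defs
begin

text \<open>Fix a unit vector \<open>e\<close> and let \<open>f\<close> be a test function with nonzero integral. The functions
  \<open>g\<^sub>t = H\<^sub>\<Phi> (T\<^bsub>te\<^esub> f)\<close> are bounded in \<open>L\<^sup>p\<close> uniformly in \<open>t\<close>. On the shell where \<open>norm x\<close> is comparable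
  to \<open>t\<close> only the values of \<open>\<Phi>\<close> on a fixed annulus enter. There a bounded piece of \<open>\<Phi>\<close> contributes
  \<open>O(1/t)\<close> to \<open>g\<^sub>t\<close> in the supremum norm, because \<open>T\<^bsub>te\<^esub> f\<close> meets each ray in relative length \<open>O(1/t)\<close>,
  while the rest of \<open>\<Phi>\<close> is small in \<open>L\<^sup>1\<close> and so is its contribution. As \<open>p < 1\<close>, the \<open>L\<^sup>p\<close> bound together
  with this uniform integrability forces \<open>g\<^sub>t \<rightarrow> 0\<close> in \<open>L\<^sup>1\<close> of the shell. Pairing \<open>g\<^sub>t\<close> with \<open>\<psi>(x/t)\<close>
  and using Fubini, the limit is also \<open>(\<integral> \<Phi>(y) \<bar>y\<bar>\<^sup>n \<psi>(\<bar>y\<bar>e) dy) (\<integral> f)\<close>, so the first factor vanishes;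
  \<open>\<psi>(z) = F(x\<^sub>0/\<bar>z\<bar>) \<bar>z\<bar>\<^bsup>-n\<^esup>\<close> turns it into \<open>H\<^sub>\<Phi> F(x\<^sub>0)\<close>. Taking \<open>f = \<bar>F\<bar>\<^sup>2\<close> avoids constructing a bump
  function.\<close>

lemma frechet_derivative_translate:
  fixes f :: "'a::euclidean_space \<Rightarrow> complex"
  shows "frechet_derivative (translate y f) (at x) = frechet_derivative f (at (x - y))"
    and "translate y f differentiable (at x) \<longleftrightarrow> f differentiable (at (x - y))"
proof -
  have *: "(translate y f has_derivative D) (at x) \<longleftrightarrow> (f has_derivative D) (at (x - y))" for D
  proof
    assume "(translate y f has_derivative D) (at x)"
    then have "(translate y f has_derivative D) (at ((x - y) + y))" by simp
    moreover have "((\<lambda>z. z + y) has_derivative (\<lambda>z. z)) (at (x - y))"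
      by (auto intro!: derivative_eq_intros)
    ultimately have "((\<lambda>z. translate y f (z + y)) has_derivative D) (at (x - y))"
      by (rule has_derivative_compose[rotated])
    then show "(f has_derivative D) (at (x - y))"
      by (simp add: translate_def)
  next
    assume "(f has_derivative D) (at (x - y))"
    moreover have "((\<lambda>z. z - y) has_derivative (\<lambda>z. z)) (at x)"
      by (auto intro!: derivative_eq_intros)
    ultimately have "((\<lambda>z. f (z - y)) has_derivative D) (at x)"
      by (rule has_derivative_compose[rotated])
    then show "(translate y f has_derivative D) (at x)"
      by (simp add: translate_def[abs_def])
  qed
  show "frechet_derivative (translate y f) (at x) = frechet_derivative f (at (x - y))"
    by (simp add: frechet_derivative_def *)
  show "translate y f differentiable (at x) \<longleftrightarrow> f differentiable (at (x - y))"
    by (simp add: differentiable_def *)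
qed

lemma partials_translate: "partials vs (translate y f) = translate y (partials vs f)"
proof (induction vs arbitrary: f)
  case (Cons v vs)
  have "(\<lambda>x. frechet_derivative (translate y f) (at x) v)
      = translate y (\<lambda>x. frechet_derivative f (at x) v)"
    by (simp only: frechet_derivative_translate) (simp add: fun_eq_iff translate_def)
  then show ?case using Cons by simp
qed simp

lemma smooth_translate: "smooth f \<Longrightarrow> smooth (translate y f)"
  by (simp add: smooth_def partials_translate frechet_derivative_translate)

lemma supp_translate:
  fixes f :: "'a::euclidean_space \<Rightarrow> complex"
  shows "supp (translate y f) = (+) y ` supp f"
proof -
  have "{x. translate y f x \<noteq> 0} = (+) y ` {x. f x \<noteq> 0}"
    by (auto simp: translate_def image_iff intro!: exI[of _ "_ - y"])
  then show ?thesis by (simp add: supp_def closure_translation)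
qed

lemma test_fun_translate:
  assumes "f \<in> test_fun UNIV" shows "translate y f \<in> test_fun UNIV"
  using assms by (auto simp: test_fun_def smooth_translate supp_translate compact_translation)

lemma translate_translate: "translate y (translate z f) = translate (y + z) f"
  by (auto simp: translate_def algebra_simps)

lemma translate_zero: "translate 0 f = f"
  by (auto simp: translate_def)

lemma test_fun_translate_iff: "translate y f \<in> test_fun UNIV \<longleftrightarrow> f \<in> test_fun UNIV"
  using test_fun_translate[of f y] test_fun_translate[of "translate y f" "-y"]
  by (auto simp: translate_translate translate_zero)

lemma smooth_coinduct:
  assumes "P f"
    and diff: "\<And>f x. P f \<Longrightarrow> f differentiable (at x)"
    and deriv: "\<And>f v. P f \<Longrightarrow> v \<in> Basis \<Longrightarrow> P (\<lambda>x. frechet_derivative f (at x) v)"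
  shows "smooth f"
proof -
  have "partials vs f differentiable (at x)" if "vs \<in> lists Basis" "P f" for vs f x
    using that by (induction vs arbitrary: f) (auto intro: diff deriv)
  with \<open>P f\<close> show ?thesis by (auto simp: smooth_def)
qed

lemma smooth_differentiable: "smooth f \<Longrightarrow> f differentiable (at x)"
  unfolding smooth_def by (metis lists.Nil partials.simps(1))

lemma smooth_deriv:
  "smooth f \<Longrightarrow> v \<in> Basis \<Longrightarrow> smooth (\<lambda>x. frechet_derivative f (at x) v)"
  unfolding smooth_def by (metis lists.Cons partials.simps(2))

text \<open>The conjugation-closed algebra generated by the smooth functions is stable under partial
  derivatives, which makes it a coinduction invariant.\<close>

inductive smooth_alg :: "('a::euclidean_space \<Rightarrow> complex) \<Rightarrow> bool" where
  base: "smooth f \<Longrightarrow> smooth_alg f"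
| add: "smooth_alg f \<Longrightarrow> smooth_alg g \<Longrightarrow> smooth_alg (\<lambda>x. f x + g x)"
| mult: "smooth_alg f \<Longrightarrow> smooth_alg g \<Longrightarrow> smooth_alg (\<lambda>x. f x * g x)"
| cnj: "smooth_alg f \<Longrightarrow> smooth_alg (\<lambda>x. cnj (f x))"

lemma smooth_alg_deriv:
  assumes "smooth_alg f"
  shows "(\<forall>x. f differentiable (at x)) \<and>
    (\<forall>v\<in>Basis. smooth_alg (\<lambda>x. frechet_derivative f (at x) v))"
  using assms
proof induction
  case (base f)
  then show ?case by (auto intro: smooth_alg.base smooth_differentiable smooth_deriv)
next
  case (add f g)
  have "((\<lambda>x. f x + g x) has_derivative
      (\<lambda>v. frechet_derivative f (at x) v + frechet_derivative g (at x) v)) (at x)" for x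
    using add.IH by (auto intro!: has_derivative_add simp: frechet_derivative_works[symmetric])
  note d = this
  have "frechet_derivative (\<lambda>x. f x + g x) (at x) =
      (\<lambda>v. frechet_derivative f (at x) v + frechet_derivative g (at x) v)" for x
    using frechet_derivative_at[OF d] by simp
  with d add.IH show ?case by (auto simp: differentiable_def intro: smooth_alg.add)
next
  case (mult f g)
  have "((\<lambda>x. f x * g x) has_derivative
      (\<lambda>v. f x * frechet_derivative g (at x) v + frechet_derivative f (at x) v * g x)) (at x)" for x
    using mult.IH by (auto intro!: has_derivative_mult simp: frechet_derivative_works[symmetric])
  note d = this
  have "frechet_derivative (\<lambda>x. f x * g x) (at x) =
      (\<lambda>v. f x * frechet_derivative g (at x) v + frechet_derivative f (at x) v * g x)" for x
    using frechet_derivative_at[OF d] by simp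
  moreover have "smooth_alg (\<lambda>x. f x * frechet_derivative g (at x) v + frechet_derivative f (at x) v * g x)"
    if "v \<in> Basis" for v
    using that mult by (intro smooth_alg.add[of "\<lambda>x. f x * frechet_derivative g (at x) v"] smooth_alg.mult) auto
  ultimately show ?case using d by (auto simp: differentiable_def)
next
  case (cnj f)
  have "((\<lambda>x. cnj (f x)) has_derivative (\<lambda>v. cnj (frechet_derivative f (at x) v))) (at x)" for x
    using cnj.IH by (auto intro!: has_derivative_cnj simp: frechet_derivative_works[symmetric])
  note d = this
  have "frechet_derivative (\<lambda>x. cnj (f x)) (at x) = (\<lambda>v. cnj (frechet_derivative f (at x) v))" for x
    using frechet_derivative_at[OF d] by simp
  with d cnj show ?case by (auto simp: differentiable_def intro: smooth_alg.cnj)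
qed

lemma smooth_mult_cnj:
  assumes "smooth f" shows "smooth (\<lambda>x. f x * cnj (f x))"
proof (rule smooth_coinduct[of smooth_alg])
  show "smooth_alg (\<lambda>x. f x * cnj (f x))"
    using assms by (intro smooth_alg.mult smooth_alg.cnj smooth_alg.base)
qed (auto dest: smooth_alg_deriv)

lemma test_fun_mult_cnj:
  assumes "f \<in> test_fun \<Omega>" shows "(\<lambda>x. f x * cnj (f x)) \<in> test_fun \<Omega>"
  using assms by (auto simp: test_fun_def supp_def smooth_mult_cnj)

lemma continuous_on_test_fun: "f \<in> test_fun \<Omega> \<Longrightarrow> continuous_on UNIV f"
  by (auto simp: test_fun_def continuous_on_eq_continuous_at
      intro!: differentiable_imp_continuous_within smooth_differentiable)

lemma distribution_of_translate:
  fixes f :: "'a::euclidean_space \<Rightarrow> complex"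
  assumes "f \<in> test_fun UNIV"
  shows "distribution_of (translate y f) = translate_dist y (distribution_of f)"
proof
  fix \<phi> :: "'a \<Rightarrow> complex"
  show "distribution_of (translate y f) \<phi> = translate_dist y (distribution_of f) \<phi>"
  proof (cases "\<phi> \<in> test_fun UNIV")
    case True
    have m: "f \<in> borel_measurable borel" "\<phi> \<in> borel_measurable borel"
      using assms True by (auto intro!: borel_measurable_continuous_onI continuous_on_test_fun)
    have "(LINT x|lebesgue. translate y f x * \<phi> x) = (LINT x|lborel. f (x - y) * \<phi> x)"
      unfolding translate_def by (rule integral_completion) (use m in measurable)
    also have "\<dots> = (LINT x|distr lborel borel ((+) y). f (x - y) * \<phi> x)"
      by (simp add: lborel_distr_plus)
    also have "\<dots> = (LINT x|lborel. f x * \<phi> (x + y))"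
      by (subst integral_distr) (use m in \<open>auto simp: algebra_simps\<close>)
    also have "\<dots> = (LINT x|lebesgue. f x * translate (- y) \<phi> x)"
      unfolding translate_def by (subst integral_completion) (use m in auto)
    finally show ?thesis
      using True by (simp add: distribution_of_def translate_dist_def test_fun_translate_iff)
  qed (simp add: distribution_of_def translate_dist_def test_fun_translate_iff)
qed

lemma fnorm_translate:
  assumes "translation_invariant X" "f \<in> funs_of X" "f \<in> test_fun UNIV"
  shows "fnorm X (translate y f) = fnorm X f"
  using assms by (cases X) (auto simp: distribution_of_translate)

lemma nn_integral_lborel_affine:
  fixes h :: "'a::euclidean_space \<Rightarrow> ennreal"
  assumes [measurable]: "h \<in> borel_measurable borel" and r: "r \<noteq> 0"
  shows "(\<integral>\<^sup>+x. h x \<partial>lborel) = ennreal (\<bar>r\<bar> ^ DIM('a)) * (\<integral>\<^sup>+x. h (c + r *\<^sub>R x) \<partial>lborel)"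
  by (subst lborel_affine[OF r, of c])
    (simp add: nn_integral_density nn_integral_distr nn_integral_cmult ennreal_power)

lemma lebesgue_integral_lborel_affine:
  fixes h :: "'a::euclidean_space \<Rightarrow> complex"
  assumes [measurable]: "h \<in> borel_measurable borel" and r: "r \<noteq> 0"
  shows "(LINT x|lborel. h x) = of_real (\<bar>r\<bar> ^ DIM('a)) * (LINT x|lborel. h (c + r *\<^sub>R x))"
  by (subst lborel_affine[OF r, of c])
    (simp add: integral_density integral_distr ennreal_power scaleR_conv_of_real)

lemma borel_measurable_translate [measurable]:
  fixes f :: "'a::euclidean_space \<Rightarrow> complex"
  assumes [measurable]: "f \<in> borel_measurable borel"
  shows "translate y f \<in> borel_measurable borel"
  unfolding translate_def[abs_def] by measurable

lemma hausdorff_op_lborel: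
  fixes f :: "'a::euclidean_space \<Rightarrow> complex"
  assumes [measurable]: "\<Phi> \<in> borel_measurable borel" "f \<in> borel_measurable borel"
  shows "hausdorff_op \<Phi> f x = (LINT y|lborel. \<Phi> y * f (x /\<^sub>R norm y))"
  unfolding hausdorff_op_def by (rule integral_completion) measurable

lemma borel_measurable_hausdorff_op:
  fixes f :: "'a::euclidean_space \<Rightarrow> complex"
  assumes [measurable]: "\<Phi> \<in> borel_measurable borel" "f \<in> borel_measurable borel"
  shows "hausdorff_op \<Phi> f \<in> borel_measurable borel"
  unfolding hausdorff_op_lborel[OF assms, abs_def] by measurable

lemma nn_integral_translate:
  fixes f :: "'a::euclidean_space \<Rightarrow> complex"
  assumes [measurable]: "f \<in> borel_measurable borel"
  shows "(\<integral>\<^sup>+x. norm (translate c f x) \<partial>lborel) = (\<integral>\<^sup>+x. norm (f x) \<partial>lborel)"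
  using nn_integral_lborel_affine[of "\<lambda>x. norm (translate c f x)" 1 c] by (simp add: translate_def)

lemma nn_integral_hausdorff_kernel:
  fixes \<Phi> f :: "'a::euclidean_space \<Rightarrow> complex"
  assumes [measurable]: "\<Phi> \<in> borel_measurable borel" "f \<in> borel_measurable borel"
    and \<beta>: "\<And>y. \<Phi> y \<noteq> 0 \<Longrightarrow> y \<noteq> 0 \<and> norm y \<le> \<beta>"
  shows "(\<integral>\<^sup>+y. \<integral>\<^sup>+x. norm (\<Phi> y * f (x /\<^sub>R norm y)) \<partial>lborel \<partial>lborel)
    \<le> ennreal (\<beta> ^ DIM('a)) * (\<integral>\<^sup>+x. norm (f x) \<partial>lborel) * (\<integral>\<^sup>+y. norm (\<Phi> y) \<partial>lborel)"
proof -
  have "(\<integral>\<^sup>+x. norm (\<Phi> y * f (x /\<^sub>R norm y)) \<partial>lborel)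
      \<le> ennreal (\<beta> ^ DIM('a)) * (\<integral>\<^sup>+x. norm (f x) \<partial>lborel) * norm (\<Phi> y)" for y
  proof (cases "\<Phi> y = 0")
    case False
    with \<beta> have y: "y \<noteq> 0" "norm y \<le> \<beta>" by auto
    have "(\<integral>\<^sup>+x. norm (\<Phi> y * f (x /\<^sub>R norm y)) \<partial>lborel)
        = norm (\<Phi> y) * (\<integral>\<^sup>+x. norm (f (x /\<^sub>R norm y)) \<partial>lborel)"
      by (simp add: norm_mult ennreal_mult nn_integral_cmult)
    also have "(\<integral>\<^sup>+x. norm (f (x /\<^sub>R norm y)) \<partial>lborel)
        = ennreal (norm y ^ DIM('a)) * (\<integral>\<^sup>+x. norm (f x) \<partial>lborel)"
      using y by (subst nn_integral_lborel_affine[of _ "norm y" 0]) auto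
    also have "norm (\<Phi> y) * (ennreal (norm y ^ DIM('a)) * (\<integral>\<^sup>+x. norm (f x) \<partial>lborel))
        \<le> norm (\<Phi> y) * (ennreal (\<beta> ^ DIM('a)) * (\<integral>\<^sup>+x. norm (f x) \<partial>lborel))"
      using y by (intro mult_left_mono mult_right_mono ennreal_leI power_mono) auto
    finally show ?thesis by (simp add: mult_ac)
  qed simp
  then have "(\<integral>\<^sup>+y. \<integral>\<^sup>+x. norm (\<Phi> y * f (x /\<^sub>R norm y)) \<partial>lborel \<partial>lborel)
    \<le> (\<integral>\<^sup>+y. ennreal (\<beta> ^ DIM('a)) * (\<integral>\<^sup>+x. norm (f x) \<partial>lborel) * norm (\<Phi> y) \<partial>lborel)"
    by (intro nn_integral_mono) auto
  then show ?thesis by (simp add: nn_integral_cmult)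
qed

lemma norm_integral_le_nn_integral:
  fixes h :: "'a \<Rightarrow> complex"
  shows "ennreal (norm (integral\<^sup>L M h)) \<le> (\<integral>\<^sup>+x. norm (h x) \<partial>M)"
proof (cases "integrable M h")
  case True
  then show ?thesis by (rule integral_norm_bound_ennreal)
qed (simp add: not_integrable_integral_eq)

lemma nn_integral_hausdorff_op_le:
  fixes \<Phi> f :: "'a::euclidean_space \<Rightarrow> complex"
  assumes [measurable]: "\<Phi> \<in> borel_measurable borel" "f \<in> borel_measurable borel"
    and \<beta>: "\<And>y. \<Phi> y \<noteq> 0 \<Longrightarrow> y \<noteq> 0 \<and> norm y \<le> \<beta>"
  shows "(\<integral>\<^sup>+x. norm (hausdorff_op \<Phi> f x) \<partial>lborel)
    \<le> ennreal (\<beta> ^ DIM('a)) * (\<integral>\<^sup>+x. norm (f x) \<partial>lborel) * (\<integral>\<^sup>+y. norm (\<Phi> y) \<partial>lborel)"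
proof -
  have "(\<integral>\<^sup>+x. norm (hausdorff_op \<Phi> f x) \<partial>lborel)
      \<le> (\<integral>\<^sup>+x. \<integral>\<^sup>+y. norm (\<Phi> y * f (x /\<^sub>R norm y)) \<partial>lborel \<partial>lborel)"
    unfolding hausdorff_op_lborel[OF assms(1,2)]
    by (intro nn_integral_mono norm_integral_le_nn_integral)
  also have "\<dots> = (\<integral>\<^sup>+y. \<integral>\<^sup>+x. norm (\<Phi> y * f (x /\<^sub>R norm y)) \<partial>lborel \<partial>lborel)"
    by (rule lborel_pair.Fubini'[symmetric]) measurable
  finally show ?thesis using nn_integral_hausdorff_kernel[OF assms] by (rule order_trans)
qed

lemma hausdorff_op_pairing:
  fixes \<Phi> f \<psi> :: "'a::euclidean_space \<Rightarrow> complex"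
  assumes \<Phi>: "integrable lborel \<Phi>" and f: "integrable lborel f"
    and [measurable]: "\<psi> \<in> borel_measurable borel" and B: "\<And>x. norm (\<psi> x) \<le> B"
    and \<beta>: "\<And>y. \<Phi> y \<noteq> 0 \<Longrightarrow> y \<noteq> 0 \<and> norm y \<le> \<beta>"
  shows "(LINT x|lborel. hausdorff_op \<Phi> f x * \<psi> x)
    = (LINT y|lborel. LINT w|lborel. \<Phi> y * of_real (norm y ^ DIM('a)) * f w * \<psi> (norm y *\<^sub>R w))"
proof -
  have [measurable]: "\<Phi> \<in> borel_measurable borel" "f \<in> borel_measurable borel"
    using \<Phi> f by auto
  have B0: "0 \<le> B" using B[of 0] norm_ge_zero order_trans by blast
  have int: "integrable (lborel \<Otimes>\<^sub>M lborel) (\<lambda>(x, y). \<Phi> y * f (x /\<^sub>R norm y))"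
  proof (rule integrableI_bounded)
    have "(\<integral>\<^sup>+z. norm (case z of (x, y) \<Rightarrow> \<Phi> y * f (x /\<^sub>R norm y)) \<partial>(lborel \<Otimes>\<^sub>M lborel))
        = (\<integral>\<^sup>+y. \<integral>\<^sup>+x. norm (\<Phi> y * f (x /\<^sub>R norm y)) \<partial>lborel \<partial>lborel)"
      by (subst lborel_pair.nn_integral_snd[symmetric]) (auto simp: split_beta')
    also have "\<dots> \<le> ennreal (\<beta> ^ DIM('a)) * (\<integral>\<^sup>+x. norm (f x) \<partial>lborel) * (\<integral>\<^sup>+y. norm (\<Phi> y) \<partial>lborel)"
      by (rule nn_integral_hausdorff_kernel) (use \<beta> in auto)
    also have "\<dots> < \<infinity>"
      using \<Phi> f by (simp add: integrable_iff_bounded ennreal_mult_less_top)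
    finally show "(\<integral>\<^sup>+z. norm (case z of (x, y) \<Rightarrow> \<Phi> y * f (x /\<^sub>R norm y)) \<partial>(lborel \<Otimes>\<^sub>M lborel)) < \<infinity>" .
  qed measurable
  have int2: "integrable (lborel \<Otimes>\<^sub>M lborel) (\<lambda>(x, y). \<Phi> y * f (x /\<^sub>R norm y) * \<psi> x)"
  proof (rule Bochner_Integration.integrable_bound)
    show "integrable (lborel \<Otimes>\<^sub>M lborel) (\<lambda>z. B *\<^sub>R (case z of (x, y) \<Rightarrow> \<Phi> y * f (x /\<^sub>R norm y)))"
      by (rule integrable_scaleR_right) (use int in auto)
    show "AE z in lborel \<Otimes>\<^sub>M lborel. norm (case z of (x, y) \<Rightarrow> \<Phi> y * f (x /\<^sub>R norm y) * \<psi> x)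
        \<le> norm (B *\<^sub>R (case z of (x, y) \<Rightarrow> \<Phi> y * f (x /\<^sub>R norm y)))"
      using B B0 by (auto simp: norm_mult split_beta' mult.commute[of B] intro!: mult_left_mono AE_I2)
  qed measurable
  have "(LINT x|lborel. hausdorff_op \<Phi> f x * \<psi> x)
      = (LINT x|lborel. LINT y|lborel. \<Phi> y * f (x /\<^sub>R norm y) * \<psi> x)"
    by (simp add: hausdorff_op_lborel)
  also have "\<dots> = (LINT y|lborel. LINT x|lborel. \<Phi> y * f (x /\<^sub>R norm y) * \<psi> x)"
    by (rule lborel_pair.Fubini_integral[symmetric]) (rule int2)
  also have "\<dots> = (LINT y|lborel. LINT w|lborel.
      \<Phi> y * of_real (norm y ^ DIM('a)) * f w * \<psi> (norm y *\<^sub>R w))"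
  proof (rule Bochner_Integration.integral_cong[OF refl])
    fix y :: 'a
    show "(LINT x|lborel. \<Phi> y * f (x /\<^sub>R norm y) * \<psi> x)
        = (LINT w|lborel. \<Phi> y * of_real (norm y ^ DIM('a)) * f w * \<psi> (norm y *\<^sub>R w))"
    proof (cases "\<Phi> y = 0")
      case False
      with \<beta> have y: "norm y \<noteq> 0" by auto
      have "(LINT x|lborel. \<Phi> y * f (x /\<^sub>R norm y) * \<psi> x)
          = of_real (norm y ^ DIM('a)) * (LINT w|lborel. \<Phi> y * (f w * \<psi> (norm y *\<^sub>R w)))"
        by (subst lebesgue_integral_lborel_affine[OF _ y, of _ 0]) (use y in \<open>auto simp: mult.assoc\<close>)
      also have "\<dots> = (LINT w|lborel. (of_real (norm y ^ DIM('a)) * \<Phi> y) * (f w * \<psi> (norm y *\<^sub>R w)))"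
        by (simp only: integral_mult_right_zero mult.assoc)
      finally show ?thesis by (simp add: mult_ac)
    qed simp
  qed
  finally show ?thesis .
qed

lemma norm_hausdorff_op_translate_le:
  fixes \<Phi> f :: "'a::euclidean_space \<Rightarrow> complex"
  assumes [measurable]: "\<Phi> \<in> borel_measurable borel" "f \<in> borel_measurable borel"
    and k: "\<And>y. norm (\<Phi> y) \<le> k" and \<beta>: "\<And>y. \<Phi> y \<noteq> 0 \<Longrightarrow> norm y \<le> \<beta>" "0 \<le> \<beta>"
    and B: "\<And>w. norm (f w) \<le> B" and R: "\<And>w. f w \<noteq> 0 \<Longrightarrow> norm w \<le> R" "0 < R"
    and e: "norm e = 1" and t: "2 * R \<le> t"
  shows "norm (hausdorff_op \<Phi> (translate (t *\<^sub>R e) f) x)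
    \<le> k * B * (unit_ball_vol DIM('a) * (3 * \<beta>) ^ DIM('a) * (2 * R * DIM('a))) / t"
proof -
  let ?n = "DIM('a)"
  let ?h = "\<lambda>y. \<Phi> y * translate (t *\<^sub>R e) f (x /\<^sub>R norm y)"
  have k0: "0 \<le> k" and B0: "0 \<le> B"
    using k[of 0] B[of 0] norm_ge_zero order_trans by blast+
  have v0: "0 \<le> unit_ball_vol (real ?n)" by simp
  have tR: "0 < t - R" "0 < t + R" "0 < t" using R t by auto
  have H: "hausdorff_op \<Phi> (translate (t *\<^sub>R e) f) x = (LINT y|lborel. ?h y)"
    by (rule hausdorff_op_lborel) measurable
  define r1 where "r1 = norm x / (t + R)"
  define r2 where "r2 = norm x / (t - R)"
  have nz: "norm y \<le> \<beta> \<and> norm x \<le> norm y * (t + R) \<and> norm y * (t - R) \<le> norm x"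
    if "?h y \<noteq> 0" for y
  proof -
    have *: "norm (x /\<^sub>R norm y - t *\<^sub>R e) \<le> R" using that R by (auto simp: translate_def)
    have y: "y \<noteq> 0" using * e tR by auto
    have "norm (t *\<^sub>R e) = t" using e tR by simp
    then have "norm (x /\<^sub>R norm y) \<le> t + R" "t - R \<le> norm (x /\<^sub>R norm y)"
      using * norm_triangle_sub[of "x /\<^sub>R norm y" "t *\<^sub>R e"]
        norm_triangle_sub[of "t *\<^sub>R e" "x /\<^sub>R norm y"] norm_minus_commute[of "t *\<^sub>R e" "x /\<^sub>R norm y"]
      by linarith+
    then show ?thesis using y \<beta>(1)[of y] that by (auto simp: divide_simps mult.commute)
  qed
  show ?thesis
  proof (cases "\<exists>y. ?h y \<noteq> 0")
    case False
    then have "?h = (\<lambda>_. 0)" by auto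
    then have "hausdorff_op \<Phi> (translate (t *\<^sub>R e) f) x = 0" unfolding H by simp
    moreover have "0 \<le> k * B * (unit_ball_vol ?n * (3 * \<beta>) ^ ?n * (2 * R * ?n)) / t"
      using k0 B0 \<beta>(2) R tR v0 by (intro divide_nonneg_nonneg mult_nonneg_nonneg) auto
    ultimately show ?thesis by simp
  next
    case True
    then obtain y0 where y0: "?h y0 \<noteq> 0" by blast
    note \<beta>0 = \<beta>(2)
    have r12: "0 \<le> r1" "r1 \<le> r2"
      using tR R by (auto simp: r1_def r2_def intro!: divide_left_mono)
    have "norm x \<le> \<beta> * (t + R)"
      using nz[OF y0] tR by (smt (verit) mult_right_mono)
    also have "\<dots> \<le> \<beta> * (3 * (t - R))" using \<beta>0 t by (intro mult_left_mono) auto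
    finally have r2: "r2 \<le> 3 * \<beta>" using tR by (simp add: r2_def divide_simps mult_ac)
    let ?S = "cball (0::'a) r2 - ball 0 r1"
    have q: "r1 = r2 * (1 + - (2 * R / (t + R)))"
      using tR by (simp add: r1_def r2_def divide_simps)
    have "1 + real ?n * (- (2 * R / (t + R))) \<le> (1 + - (2 * R / (t + R))) ^ ?n"
      using tR R by (intro Bernoulli_inequality) (simp add: divide_simps)
    moreover have "2 * R / (t + R) \<le> 2 * R / t" using R tR by (intro divide_left_mono) auto
    then have "real ?n * (2 * R / (t + R)) \<le> real ?n * (2 * R / t)" by (intro mult_left_mono) auto
    ultimately have "1 - (1 + - (2 * R / (t + R))) ^ ?n \<le> real ?n * (2 * R / t)" by linarith
    then have "r2 ^ ?n * (1 - (1 + - (2 * R / (t + R))) ^ ?n) \<le> r2 ^ ?n * (real ?n * (2 * R / t))"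
      using r12 by (intro mult_left_mono) auto
    also have "\<dots> \<le> (3 * \<beta>) ^ ?n * (real ?n * (2 * R / t))"
      using r12 r2 R tR by (intro mult_right_mono power_mono) auto
    finally have r: "r2 ^ ?n - r1 ^ ?n \<le> (3 * \<beta>) ^ ?n * (real ?n * (2 * R / t))"
      unfolding q power_mult_distrib by (simp only: right_diff_distrib mult_1_right)
    have "emeasure lborel ?S = emeasure lborel (cball (0::'a) r2) - emeasure lborel (ball (0::'a) r1)"
      using r12 by (intro emeasure_Diff) (auto simp: emeasure_ball)
    also have "\<dots> = ennreal (unit_ball_vol ?n * (r2 ^ ?n - r1 ^ ?n))"
      using r12 by (simp add: emeasure_ball emeasure_cball ennreal_minus right_diff_distrib)
    also have "\<dots> \<le> ennreal (unit_ball_vol ?n * ((3 * \<beta>) ^ ?n * (real ?n * (2 * R / t))))"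
      using r by (intro ennreal_leI mult_left_mono) auto
    finally have S: "emeasure lborel ?S \<le> ennreal (unit_ball_vol ?n * ((3 * \<beta>) ^ ?n * (real ?n * (2 * R / t))))" .
    have "ennreal (norm (hausdorff_op \<Phi> (translate (t *\<^sub>R e) f) x)) \<le> (\<integral>\<^sup>+y. norm (?h y) \<partial>lborel)"
      unfolding H by (rule norm_integral_le_nn_integral)
    also have "\<dots> \<le> (\<integral>\<^sup>+y. ennreal (k * B) * indicator ?S y \<partial>lborel)"
    proof (rule nn_integral_mono)
      fix y
      show "ennreal (norm (?h y)) \<le> ennreal (k * B) * indicator ?S y"
      proof (cases "?h y = 0")
        case False
        then have "y \<in> ?S" using nz[OF False] tR by (auto simp: r1_def r2_def divide_simps mult.commute)
        then show ?thesis
          using k[of y] B k0 B0 by (auto simp: norm_mult translate_def intro!: ennreal_leI mult_mono)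
      qed (simp only: norm_zero ennreal_0 zero_le)
    qed
    also have "\<dots> = ennreal (k * B) * emeasure lborel ?S"
      by (rule nn_integral_cmult_indicator) simp
    also have "\<dots> \<le> ennreal (k * B) * ennreal (unit_ball_vol ?n * ((3 * \<beta>) ^ ?n * (real ?n * (2 * R / t))))"
      by (intro mult_left_mono S) auto
    also have "\<dots> = ennreal (k * B * (unit_ball_vol ?n * ((3 * \<beta>) ^ ?n * (real ?n * (2 * R / t)))))"
      using k0 B0 by (intro ennreal_mult'[symmetric] mult_nonneg_nonneg)
    finally show ?thesis
      using k0 B0 R tR \<beta>0 by (subst (asm) ennreal_le_iff) (auto simp: mult_ac)
  qed
qed

lemma integrable_product_lborel:
  fixes f g :: "'a::euclidean_space \<Rightarrow> complex"
  assumes f: "integrable lborel f" and g: "integrable lborel g"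
  shows "integrable (lborel \<Otimes>\<^sub>M lborel) (\<lambda>(x, y). f x * g y)"
proof (rule integrableI_bounded)
  have [measurable]: "f \<in> borel_measurable borel" "g \<in> borel_measurable borel"
    using f g by auto
  show "(\<lambda>(x, y). f x * g y) \<in> borel_measurable (lborel \<Otimes>\<^sub>M lborel)" by measurable
  have "(\<integral>\<^sup>+z. norm (case z of (x, y) \<Rightarrow> f x * g y) \<partial>(lborel \<Otimes>\<^sub>M lborel))
      = (\<integral>\<^sup>+x. \<integral>\<^sup>+y. ennreal (norm (f x)) * ennreal (norm (g y)) \<partial>lborel \<partial>lborel)"
    by (subst lborel.nn_integral_fst[symmetric]) (auto simp: split_beta' norm_mult ennreal_mult)
  also have "\<dots> = (\<integral>\<^sup>+x. norm (f x) \<partial>lborel) * (\<integral>\<^sup>+y. norm (g y) \<partial>lborel)"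
    by (simp add: nn_integral_cmult nn_integral_multc)
  also have "\<dots> < \<infinity>" using f g by (simp add: integrable_iff_bounded ennreal_mult_less_top)
  finally show "(\<integral>\<^sup>+z. norm (case z of (x, y) \<Rightarrow> f x * g y) \<partial>(lborel \<Otimes>\<^sub>M lborel)) < \<infinity>" .
qed

lemma integrable_translate:
  fixes f :: "'a::euclidean_space \<Rightarrow> complex"
  assumes "integrable lborel f" shows "integrable lborel (translate c f)"
proof -
  have [measurable]: "f \<in> borel_measurable borel" using assms by auto
  show ?thesis using assms by (simp add: integrable_iff_bounded nn_integral_translate)
qed

lemma tendsto_hausdorff_op_pairing:
  fixes \<Phi> f \<psi> :: "'a::euclidean_space \<Rightarrow> complex"
  assumes \<Phi>: "integrable lborel \<Phi>" and f: "integrable lborel f"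
    and \<psi>[measurable]: "\<psi> \<in> borel_measurable borel" and B: "\<And>x. norm (\<psi> x) \<le> B"
    and \<beta>: "\<And>y. \<Phi> y \<noteq> 0 \<Longrightarrow> y \<noteq> 0 \<and> norm y \<le> \<beta>"
    and cont: "\<And>r. 0 < r \<Longrightarrow> isCont \<psi> (r *\<^sub>R e)"
  shows "((\<lambda>t. LINT x|lborel. hausdorff_op \<Phi> (translate (t *\<^sub>R e) f) x * \<psi> (x /\<^sub>R t))
    \<longlongrightarrow> (LINT y|lborel. \<Phi> y * of_real (norm y ^ DIM('a)) * \<psi> (norm y *\<^sub>R e)) * (LINT w|lborel. f w)) at_top"
proof -
  let ?M = "lborel \<Otimes>\<^sub>M lborel :: ('a \<times> 'a) measure"
  let ?n = "DIM('a)"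
  have [measurable]: "\<Phi> \<in> borel_measurable borel" "f \<in> borel_measurable borel"
    using \<Phi> f by auto
  have B0: "0 \<le> B" using B[of 0] norm_ge_zero order_trans by blast
  define s where "s t = (\<lambda>(y, w). \<Phi> y * of_real (norm y ^ ?n) * f w * \<psi> (norm y *\<^sub>R (e + w /\<^sub>R t)))" for t
  define s0 where "s0 = (\<lambda>(y, w). \<Phi> y * of_real (norm y ^ ?n) * f w * \<psi> (norm y *\<^sub>R e))"
  define b where "b = (\<lambda>z. \<beta> ^ ?n * B * norm ((\<lambda>(y, w). \<Phi> y * f w) z))"
  have b: "integrable ?M b"
    unfolding b_def using integrable_product_lborel[OF \<Phi> f] by auto
  have *: "norm (\<Phi> y * of_real (norm y ^ ?n) * f w * \<psi> z) \<le> b (y, w)" for y w z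
  proof (cases "\<Phi> y = 0")
    case False
    with \<beta> have "norm y \<le> \<beta>" by auto
    moreover from this have "0 \<le> \<beta>" using norm_ge_zero order_trans by blast
    ultimately have "norm y ^ ?n * norm (\<psi> z) * norm (\<Phi> y * f w) \<le> \<beta> ^ ?n * B * norm (\<Phi> y * f w)"
      using B[of z] by (intro mult_right_mono mult_mono power_mono) auto
    then show ?thesis by (simp add: b_def norm_mult norm_power mult_ac)
  qed (simp add: b_def)
  have sm[measurable]: "s t \<in> borel_measurable ?M" "s0 \<in> borel_measurable ?M" for t
    unfolding s_def s0_def by measurable
  have sb: "norm (s t z) \<le> b z" "norm (s0 z) \<le> b z" for t z
    using * by (auto simp: s_def s0_def split: prod.split)
  have int: "integrable ?M (s t)" "integrable ?M s0" for t
    by (rule Bochner_Integration.integrable_bound[OF b];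
      use sb in \<open>auto intro!: AE_I2 intro: order_trans[OF _ abs_ge_self]\<close>)+
  have lim: "((\<lambda>t. integral\<^sup>L ?M (s t)) \<longlongrightarrow> integral\<^sup>L ?M s0) at_top"
  proof (rule integral_dominated_convergence_at_top[OF _ _ b])
    show "AE z in ?M. ((\<lambda>t. s t z) \<longlongrightarrow> s0 z) at_top"
    proof (rule AE_I2, safe)
      fix y w :: 'a
      show "((\<lambda>t. s t (y, w)) \<longlongrightarrow> s0 (y, w)) at_top"
      proof (cases "\<Phi> y = 0")
        case False
        with \<beta> have y: "0 < norm y" by auto
        have "((\<lambda>t. norm y *\<^sub>R (e + w /\<^sub>R t)) \<longlongrightarrow> norm y *\<^sub>R (e + 0 *\<^sub>R w)) at_top"
          by (intro tendsto_intros tendsto_inverse_0_at_top filterlim_ident)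
        then have "((\<lambda>t. \<psi> (norm y *\<^sub>R (e + w /\<^sub>R t))) \<longlongrightarrow> \<psi> (norm y *\<^sub>R e)) at_top"
          using isCont_tendsto_compose[OF cont[OF y]] by simp
        then show ?thesis unfolding s_def s0_def by (auto intro!: tendsto_intros)
      qed (simp add: s_def s0_def)
    qed
  qed (use sb in \<open>auto intro!: always_eventually\<close>)
  have eq: "(LINT x|lborel. hausdorff_op \<Phi> (translate (t *\<^sub>R e) f) x * \<psi> (x /\<^sub>R t)) = integral\<^sup>L ?M (s t)"
    if "0 < t" for t
  proof -
    have "(LINT x|lborel. hausdorff_op \<Phi> (translate (t *\<^sub>R e) f) x * \<psi> (x /\<^sub>R t))
      = (LINT y|lborel. LINT w|lborel. \<Phi> y * of_real (norm y ^ ?n) * translate (t *\<^sub>R e) f w *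
          \<psi> ((norm y *\<^sub>R w) /\<^sub>R t))"
      using hausdorff_op_pairing[OF \<Phi> integrable_translate[OF f], of "\<lambda>x. \<psi> (x /\<^sub>R t)" B \<beta> "t *\<^sub>R e"] B \<beta>
      by auto
    also have "\<dots> = (LINT y|lborel. LINT w|lborel. s t (y, w))"
    proof (rule Bochner_Integration.integral_cong[OF refl])
      fix y :: 'a
      have [measurable]: "translate (t *\<^sub>R e) f \<in> borel_measurable borel" by measurable
      have st: "(norm y *\<^sub>R (t *\<^sub>R e + w)) /\<^sub>R t = norm y *\<^sub>R (e + w /\<^sub>R t)" for w
        using that by (simp add: scaleR_add_right mult.commute)
      show "(LINT w|lborel. \<Phi> y * of_real (norm y ^ ?n) * translate (t *\<^sub>R e) f w *
          \<psi> ((norm y *\<^sub>R w) /\<^sub>R t)) = (LINT w|lborel. s t (y, w))"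
        by (subst lebesgue_integral_lborel_affine[of _ 1 "t *\<^sub>R e"])
          (simp_all add: s_def translate_def st del: scaleR_scaleR)
    qed
    also have "\<dots> = integral\<^sup>L ?M (s t)" by (rule lborel_pair.integral_fst'[OF int(1)])
    finally show ?thesis .
  qed
  have "integral\<^sup>L ?M s0 = (LINT y|lborel. LINT w|lborel. s0 (y, w))"
    by (rule lborel_pair.integral_fst'[OF int(2), symmetric])
  also have "\<dots> = (LINT y|lborel. LINT w|lborel. (\<Phi> y * of_real (norm y ^ ?n) * \<psi> (norm y *\<^sub>R e)) * f w)"
    by (simp add: s0_def mult_ac)
  also have "\<dots> = (LINT y|lborel. \<Phi> y * of_real (norm y ^ ?n) * \<psi> (norm y *\<^sub>R e)) * (LINT w|lborel. f w)"
    by (simp only: integral_mult_right_zero integral_mult_left_zero)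
  finally have "((\<lambda>t. integral\<^sup>L ?M (s t)) \<longlongrightarrow>
      (LINT y|lborel. \<Phi> y * of_real (norm y ^ DIM('a)) * \<psi> (norm y *\<^sub>R e)) * (LINT w|lborel. f w)) at_top"
    using lim by simp
  then show ?thesis
    by (rule Lim_transform_eventually)
      (use eq in \<open>auto intro: eventually_mono[OF eventually_gt_at_top[of 0]]\<close>)
qed

lemma hausdorff_op_add:
  fixes \<Phi> \<Psi> f :: "'a::euclidean_space \<Rightarrow> complex"
  assumes \<Phi>: "integrable lborel \<Phi>" and \<Psi>: "integrable lborel \<Psi>"
    and [measurable]: "f \<in> borel_measurable borel" and B: "\<And>w. norm (f w) \<le> B"
  shows "hausdorff_op (\<lambda>y. \<Phi> y + \<Psi> y) f x = hausdorff_op \<Phi> f x + hausdorff_op \<Psi> f x"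
proof -
  have [measurable]: "\<Phi> \<in> borel_measurable borel" "\<Psi> \<in> borel_measurable borel"
    using \<Phi> \<Psi> by auto
  have "integrable lborel (\<lambda>y. \<Theta> y * f (x /\<^sub>R norm y))" if \<Theta>: "integrable lborel \<Theta>" for \<Theta> :: "'a \<Rightarrow> complex"
  proof (rule Bochner_Integration.integrable_bound)
    show "integrable lborel (\<lambda>y. of_real B * \<Theta> y)" using \<Theta> by simp
    have [measurable]: "\<Theta> \<in> borel_measurable borel" using \<Theta> by auto
    show "(\<lambda>y. \<Theta> y * f (x /\<^sub>R norm y)) \<in> borel_measurable lborel" by measurable
    show "AE y in lborel. norm (\<Theta> y * f (x /\<^sub>R norm y)) \<le> norm (of_real B * \<Theta> y)"
      using B by (auto simp: norm_mult mult.commute[of "norm (\<Theta> _)"]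
        intro!: AE_I2 mult_right_mono intro: order_trans[OF _ abs_ge_self])
  qed
  then show ?thesis using \<Phi> \<Psi> by (simp add: hausdorff_op_lborel distrib_right)
qed

lemma tendsto_L1_truncation:
  fixes \<Phi> :: "'a \<Rightarrow> complex"
  assumes \<Phi>: "integrable M \<Phi>"
  shows "(\<lambda>k::nat. LINT y|M. norm (if norm (\<Phi> y) \<le> real k then 0 else \<Phi> y)) \<longlonglongrightarrow> 0"
proof -
  have [measurable]: "\<Phi> \<in> borel_measurable M" using \<Phi> by auto
  have "(\<lambda>k::nat. LINT y|M. norm (if norm (\<Phi> y) \<le> real k then 0 else \<Phi> y)) \<longlonglongrightarrow> (LINT y|M. 0)"
  proof (rule integral_dominated_convergence[where w = "\<lambda>y. norm (\<Phi> y)"])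
    show "AE y in M. (\<lambda>k. norm (if norm (\<Phi> y) \<le> real k then 0 else \<Phi> y)) \<longlonglongrightarrow> 0"
    proof (rule AE_I2)
      fix y
      have "\<forall>\<^sub>F k in sequentially. norm (\<Phi> y) \<le> real k"
        using filterlim_real_sequentially by (auto simp: filterlim_at_top)
      then show "(\<lambda>k. norm (if norm (\<Phi> y) \<le> real k then 0 else \<Phi> y)) \<longlonglongrightarrow> 0"
        by (intro tendsto_eventually) (simp add: eventually_mono)
    qed
  qed (use \<Phi> in auto)
  then show ?thesis by simp
qed

text \<open>Where \<open>norm u \<le> l\<close> interpolate \<open>norm u\<close> between \<open>norm u powr p\<close> and \<open>l\<close>; elsewhere the bounded part makes up
  at most half of \<open>u\<close>.\<close>

lemma norm_le_powr_plus_remainder: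
  fixes u v :: "'a::real_normed_vector"
  assumes "0 < p" "p < 1" and u: "norm u \<le> l / 2 + norm v"
  shows "norm u \<le> l powr (1 - p) * norm u powr p + 2 * norm v"
proof (cases "norm u \<le> l")
  case True
  have "norm u = norm u powr (1 - p) * norm u powr p"
    by (simp flip: powr_add)
  also have "\<dots> \<le> l powr (1 - p) * norm u powr p"
    using True assms by (intro mult_right_mono powr_mono2) auto
  finally show ?thesis by (simp add: add_increasing2)
next
  case False
  then have "norm u \<le> 2 * norm v" using u by linarith
  then show ?thesis by (simp add: add_increasing)
qed

lemma hausdorff_op_pairing_bound:
  fixes \<Phi> f \<psi> :: "'a::euclidean_space \<Rightarrow> complex" and k t :: real
  assumes p: "0 < p" "p < 1"
    and \<Phi>: "integrable lborel \<Phi>" and \<beta>: "\<And>y. \<Phi> y \<noteq> 0 \<Longrightarrow> y \<noteq> 0 \<and> norm y \<le> \<beta>" "0 \<le> \<beta>"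
    and f: "integrable lborel f" and B: "\<And>w. norm (f w) \<le> B"
    and R: "\<And>w. f w \<noteq> 0 \<Longrightarrow> norm w \<le> R" "0 < R"
    and e: "norm e = 1"
    and \<psi>[measurable]: "\<psi> \<in> borel_measurable borel" and D: "\<And>x. norm (\<psi> x) \<le> D"
    and M: "0 \<le> M"
      "(\<integral>\<^sup>+x. ennreal (norm (hausdorff_op \<Phi> (translate (t *\<^sub>R e) f) x) powr p) *
        indicator {x. \<psi> (x /\<^sub>R t) \<noteq> 0} x \<partial>lborel) \<le> ennreal M"
    and t: "2 * R \<le> t" and k: "0 \<le> k"
  defines "c \<equiv> 2 * k * B * (unit_ball_vol DIM('a) * (3 * \<beta>) ^ DIM('a) * (2 * R * DIM('a)))"
  shows "norm (LINT x|lborel. hausdorff_op \<Phi> (translate (t *\<^sub>R e) f) x * \<psi> (x /\<^sub>R t))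
    \<le> D * ((c / t) powr (1 - p) * M +
        2 * (\<beta> ^ DIM('a) * (LINT w|lborel. norm (f w)) *
          (LINT y|lborel. norm (if norm (\<Phi> y) \<le> k then 0 else \<Phi> y))))"
proof -
  have m[measurable]: "\<Phi> \<in> borel_measurable borel" "f \<in> borel_measurable borel"
    using \<Phi> f by auto
  have D0: "0 \<le> D" using D[of 0] norm_ge_zero order_trans by blast
  define \<Phi>1 where "\<Phi>1 = (\<lambda>y. if norm (\<Phi> y) \<le> k then \<Phi> y else 0)"
  define \<Phi>2 where "\<Phi>2 = (\<lambda>y. if norm (\<Phi> y) \<le> k then 0 else \<Phi> y)"
  have m12[measurable]: "\<Phi>1 \<in> borel_measurable borel" "\<Phi>2 \<in> borel_measurable borel"
    unfolding \<Phi>1_def \<Phi>2_def by measurable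
  have i1: "integrable lborel \<Phi>1" and i2: "integrable lborel \<Phi>2"
    by (rule Bochner_Integration.integrable_bound[OF \<Phi>]; auto simp: \<Phi>1_def \<Phi>2_def)+
  let ?f = "translate (t *\<^sub>R e) f"
  let ?A = "{x. \<psi> (x /\<^sub>R t) \<noteq> 0}"
  define u where "u = hausdorff_op \<Phi> ?f"
  define v where "v = hausdorff_op \<Phi>2 ?f"
  have mf[measurable]: "?f \<in> borel_measurable borel" by measurable
  have [measurable]: "u \<in> borel_measurable borel" "v \<in> borel_measurable borel"
    unfolding u_def v_def by (intro borel_measurable_hausdorff_op m12 m mf)+
  have "norm (u x) \<le> (c / t) / 2 + norm (v x)" for x
  proof -
    have "u x = hausdorff_op (\<lambda>y. \<Phi>1 y + \<Phi>2 y) ?f x"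
      unfolding u_def by (rule arg_cong[of _ _ "\<lambda>\<Theta>. hausdorff_op \<Theta> ?f x"]) (auto simp: \<Phi>1_def \<Phi>2_def)
    also have "\<dots> = hausdorff_op \<Phi>1 ?f x + v x"
      unfolding v_def by (rule hausdorff_op_add[OF i1 i2 mf, of B]) (simp add: translate_def B)
    finally have "norm (u x) \<le> norm (hausdorff_op \<Phi>1 ?f x) + norm (v x)"
      by (simp add: norm_triangle_ineq)
    moreover have "norm (hausdorff_op \<Phi>1 ?f x)
        \<le> k * B * (unit_ball_vol DIM('a) * (3 * \<beta>) ^ DIM('a) * (2 * R * DIM('a))) / t"
      by (rule norm_hausdorff_op_translate_le)
        (use k \<beta> B R e t in \<open>auto simp: \<Phi>1_def split: if_splits\<close>)
    then have "norm (hausdorff_op \<Phi>1 ?f x) \<le> (c / t) / 2" by (simp add: c_def mult_ac)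
    ultimately show ?thesis by linarith
  qed
  then have uv: "norm (u x) \<le> (c / t) powr (1 - p) * norm (u x) powr p + 2 * norm (v x)" for x
    by (rule norm_le_powr_plus_remainder[OF p])
  define N where "N = \<beta> ^ DIM('a) * (LINT w|lborel. norm (f w)) * (LINT y|lborel. norm (\<Phi>2 y))"
  have N0: "0 \<le> N" unfolding N_def using \<beta>(2) by (intro mult_nonneg_nonneg) auto
  have "(\<integral>\<^sup>+x. norm (v x) \<partial>lborel) \<le> ennreal (\<beta> ^ DIM('a)) * (\<integral>\<^sup>+x. norm (?f x) \<partial>lborel) *
      (\<integral>\<^sup>+y. norm (\<Phi>2 y) \<partial>lborel)"
    unfolding v_def by (rule nn_integral_hausdorff_op_le) (use \<beta> in \<open>auto simp: \<Phi>2_def split: if_splits\<close>)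
  also have "\<dots> = ennreal N"
    using f i2 \<beta>(2) by (simp add: nn_integral_translate nn_integral_eq_integral N_def ennreal_mult)
  finally have vN: "(\<integral>\<^sup>+x. norm (v x) \<partial>lborel) \<le> ennreal N" .
  have "ennreal (norm (LINT x|lborel. u x * \<psi> (x /\<^sub>R t))) \<le> (\<integral>\<^sup>+x. norm (u x * \<psi> (x /\<^sub>R t)) \<partial>lborel)"
    by (rule norm_integral_le_nn_integral)
  also have "\<dots> \<le> (\<integral>\<^sup>+x. ennreal (D * (c / t) powr (1 - p)) * (ennreal (norm (u x) powr p) * indicator ?A x)
      + ennreal (D * 2) * ennreal (norm (v x)) \<partial>lborel)"
  proof (rule nn_integral_mono)
    fix x
    show "ennreal (norm (u x * \<psi> (x /\<^sub>R t))) \<le>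
      ennreal (D * (c / t) powr (1 - p)) * (ennreal (norm (u x) powr p) * indicator ?A x)
      + ennreal (D * 2) * ennreal (norm (v x))"
    proof (cases "x \<in> ?A")
      case True
      have "norm (u x * \<psi> (x /\<^sub>R t)) \<le> ((c / t) powr (1 - p) * norm (u x) powr p + 2 * norm (v x)) * D"
        unfolding norm_mult by (intro mult_mono uv D) auto
      also have "\<dots> = (D * (c / t) powr (1 - p)) * norm (u x) powr p + (D * 2) * norm (v x)"
        by (simp add: algebra_simps)
      finally show ?thesis
        using True D0 by (simp add: ennreal_mult'[symmetric] ennreal_plus[symmetric] del: ennreal_plus)
    qed simp
  qed
  also have "\<dots> = ennreal (D * (c / t) powr (1 - p)) *
        (\<integral>\<^sup>+x. ennreal (norm (u x) powr p) * indicator ?A x \<partial>lborel)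
      + ennreal (D * 2) * (\<integral>\<^sup>+x. norm (v x) \<partial>lborel)"
    by (simp add: nn_integral_add nn_integral_cmult)
  also have "\<dots> \<le> ennreal (D * (c / t) powr (1 - p)) * ennreal M + ennreal (D * 2) * ennreal N"
    using M(2) vN unfolding u_def by (intro add_mono mult_left_mono) auto
  also have "\<dots> = ennreal (D * ((c / t) powr (1 - p) * M + 2 * N))"
    using D0 M(1) N0 by (simp add: ennreal_mult'[symmetric] ennreal_plus[symmetric] algebra_simps del: ennreal_plus)
  finally show ?thesis
    using D0 M(1) N0 unfolding N_def u_def \<Phi>2_def by (subst (asm) ennreal_le_iff) auto
qed

lemma hausdorff_limit_eq_zero:
  fixes \<Phi> f \<psi> :: "'a::euclidean_space \<Rightarrow> complex"
  assumes p: "0 < p" "p < 1"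
    and \<Phi>: "integrable lborel \<Phi>" and \<beta>: "\<And>y. \<Phi> y \<noteq> 0 \<Longrightarrow> y \<noteq> 0 \<and> norm y \<le> \<beta>" "0 \<le> \<beta>"
    and f: "integrable lborel f" and B: "\<And>w. norm (f w) \<le> B"
    and R: "\<And>w. f w \<noteq> 0 \<Longrightarrow> norm w \<le> R" "0 < R"
    and e: "norm e = 1"
    and \<psi>: "\<psi> \<in> borel_measurable borel" and D: "\<And>x. norm (\<psi> x) \<le> D"
    and cont: "\<And>r. 0 < r \<Longrightarrow> isCont \<psi> (r *\<^sub>R e)"
    and M: "0 \<le> M"
      "\<And>t. t0 \<le> t \<Longrightarrow> (\<integral>\<^sup>+x. ennreal (norm (hausdorff_op \<Phi> (translate (t *\<^sub>R e) f) x) powr p) *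
        indicator {x. \<psi> (x /\<^sub>R t) \<noteq> 0} x \<partial>lborel) \<le> ennreal M"
  shows "(LINT y|lborel. \<Phi> y * of_real (norm y ^ DIM('a)) * \<psi> (norm y *\<^sub>R e)) * (LINT w|lborel. f w) = 0"
    (is "?L = 0")
proof -
  define N where "N k = LINT y|lborel. norm (if norm (\<Phi> y) \<le> k then 0 else \<Phi> y)" for k
  define E where "E = \<beta> ^ DIM('a) * (LINT w|lborel. norm (f w))"
  have lim: "((\<lambda>t. LINT x|lborel. hausdorff_op \<Phi> (translate (t *\<^sub>R e) f) x * \<psi> (x /\<^sub>R t)) \<longlongrightarrow> ?L) at_top"
    by (rule tendsto_hausdorff_op_pairing[OF \<Phi> f \<psi> D \<beta>(1) cont])
  have "norm ?L \<le> D * (2 * (E * N (real k)))" for k :: nat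
  proof -
    define c where "c = 2 * real k * B * (unit_ball_vol DIM('a) * (3 * \<beta>) ^ DIM('a) * (2 * R * DIM('a)))"
    have B0: "0 \<le> B" using B[of 0] norm_ge_zero order_trans by blast
    have c0: "0 \<le> c" unfolding c_def using \<beta>(2) R(2) B0 by (intro mult_nonneg_nonneg) auto
    have "((\<lambda>t. (c / t) powr (1 - p)) \<longlongrightarrow> 0) at_top"
    proof (rule tendsto_zero_powrI[OF _ tendsto_const])
      show "((\<lambda>t. c / t) \<longlongrightarrow> 0) at_top"
        by (intro tendsto_divide_0[OF tendsto_const] filterlim_at_top_imp_at_infinity filterlim_ident)
      show "\<forall>\<^sub>F t in at_top. 0 \<le> c / t"
        using eventually_gt_at_top[of 0] by eventually_elim (use c0 in simp)
    qed (use p in auto)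
    then have "((\<lambda>t. D * ((c / t) powr (1 - p) * M + 2 * (E * N (real k))))
        \<longlongrightarrow> D * (0 * M + 2 * (E * N (real k)))) at_top"
      by (intro tendsto_intros)
    moreover have "\<forall>\<^sub>F t in at_top.
        norm (LINT x|lborel. hausdorff_op \<Phi> (translate (t *\<^sub>R e) f) x * \<psi> (x /\<^sub>R t))
        \<le> D * ((c / t) powr (1 - p) * M + 2 * (E * N (real k)))"
      using eventually_ge_at_top[of "max t0 (2 * R)"]
    proof eventually_elim
      case (elim t)
      then show ?case unfolding c_def E_def N_def
        by (intro hausdorff_op_pairing_bound[OF p \<Phi> \<beta> f B R e \<psi> D M(1) M(2)]) auto
    qed
    ultimately show ?thesis
      using tendsto_le[OF _ _ tendsto_norm[OF lim]] by fastforce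
  qed
  moreover have "(\<lambda>k. D * (2 * (E * N (real k)))) \<longlonglongrightarrow> D * (2 * (E * 0))"
    unfolding N_def by (intro tendsto_intros tendsto_L1_truncation \<Phi>)
  ultimately have "norm ?L \<le> D * (2 * (E * 0))"
    by (intro LIMSEQ_le_const) auto
  then show ?thesis by simp
qed

lemma ex_borel_eq_AE_lebesgue:
  fixes g :: "'a::euclidean_space \<Rightarrow> complex"
  assumes [measurable]: "g \<in> borel_measurable lebesgue"
  obtains g' where "g' \<in> borel_measurable borel" "AE x in lebesgue. g x = g' x"
proof -
  have "(\<lambda>x. Re (g x)) \<in> borel_measurable lebesgue" "(\<lambda>x. Im (g x)) \<in> borel_measurable lebesgue"
    by measurable
  from this[THEN completion_ex_borel_measurable_real]
  obtain u v where uv: "u \<in> borel_measurable lborel" "AE x in lborel. Re (g x) = u x"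
      "v \<in> borel_measurable lborel" "AE x in lborel. Im (g x) = v x"
    by blast
  have "AE x in lborel. g x = Complex (u x) (v x)"
    using uv(2,4) by eventually_elim (simp add: complex_eq_iff)
  moreover have "(\<lambda>x. Complex (u x) (v x)) \<in> borel_measurable borel"
    using uv by (auto simp: borel_measurable_complex_iff)
  ultimately show thesis using that AE_completion by blast
qed

lemma hausdorff_op_cong_AE:
  fixes \<Phi> :: "'a::euclidean_space \<Rightarrow> complex"
  assumes [measurable]: "\<Phi> \<in> borel_measurable lebesgue" "\<Phi>' \<in> borel_measurable lebesgue"
    and f: "f \<in> borel_measurable borel" and eq: "AE y in lebesgue. \<Phi> y = \<Phi>' y"
  shows "hausdorff_op \<Phi> f x = hausdorff_op \<Phi>' f x"
proof -
  have "(\<lambda>y. f (x /\<^sub>R norm y)) \<in> borel_measurable lborel"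
    using f by measurable
  from measurable_completion[OF this]
  have [measurable]: "(\<lambda>y. f (x /\<^sub>R norm y)) \<in> borel_measurable lebesgue" .
  show ?thesis unfolding hausdorff_op_def
    by (rule integral_cong_AE) (use eq in \<open>auto elim: eventually_mono\<close>)
qed

lemma nn_integral_powr_le_of_Lp_norm_le:
  assumes p: "0 < p" and A: "Lp_norm p g \<le> ennreal A"
  shows "(\<integral>\<^sup>+x. ennreal (norm (g x) powr p) \<partial>lborel) \<le> ennreal (max 0 A powr p)"
proof -
  define I where "I = (\<integral>\<^sup>+x. ennreal (norm (g x) powr p) \<partial>lborel)"
  have Lp: "Lp_norm p g = (if I = \<infinity> then \<infinity> else ennreal (enn2real I powr (1 / p)))"
    by (simp add: Lp_norm_def I_def nn_integral_completion Let_def)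
  have I: "I \<noteq> \<infinity>" using A by (auto simp: Lp top_unique)
  have "ennreal (enn2real I powr (1 / p)) \<le> ennreal (max 0 A)"
    using A I by (simp add: Lp ennreal_max_0)
  then have "enn2real I powr (1 / p) \<le> max 0 A" by (subst (asm) ennreal_le_iff) auto
  then have "(enn2real I powr (1 / p)) powr p \<le> max 0 A powr p"
    using p by (intro powr_mono2) auto
  then have "enn2real I \<le> max 0 A powr p" using p by (simp add: powr_powr)
  then have "ennreal (enn2real I) \<le> ennreal (max 0 A powr p)" by (rule ennreal_leI)
  moreover have "ennreal (enn2real I) = I" using I by (simp add: less_top)
  ultimately have "I \<le> ennreal (max 0 A powr p)" by (simp only:)
  then show ?thesis by (simp only: I_def)
qed

lemma integrable_test_fun:
  fixes f :: "'a::euclidean_space \<Rightarrow> complex"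
  assumes "f \<in> test_fun \<Omega>" shows "integrable lborel f"
proof -
  have "integrable lborel (\<lambda>x. indicator (supp f) x *\<^sub>R f x)"
    using assms by (intro borel_integrable_compact continuous_on_subset[OF continuous_on_test_fun])
      (auto simp: test_fun_def)
  also have "(\<lambda>x. indicator (supp f) x *\<^sub>R f x) = f"
    using closure_subset[of "{x. f x \<noteq> 0}"] by (force simp: supp_def indicator_def fun_eq_iff)
  finally show ?thesis .
qed

lemma test_fun_bounded:
  fixes f :: "'a::euclidean_space \<Rightarrow> complex"
  assumes f: "f \<in> test_fun \<Omega>" obtains B where "\<And>x. norm (f x) \<le> B"
proof -
  have "compact (f ` supp f)"
    using f by (intro compact_continuous_image continuous_on_subset[OF continuous_on_test_fun])
      (auto simp: test_fun_def)
  then obtain B where B: "B > 0" "\<And>x. x \<in> supp f \<Longrightarrow> norm (f x) \<le> B"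
    using compact_imp_bounded by (force simp: bounded_pos)
  have "norm (f x) \<le> B" for x
    using B closure_subset[of "{x. f x \<noteq> 0}"] by (cases "f x = 0") (auto simp: supp_def)
  with that show thesis by blast
qed

lemma integral_mult_cnj_nonzero:
  fixes f :: "'a::euclidean_space \<Rightarrow> complex"
  assumes cont: "continuous_on UNIV f" and int: "integrable lborel (\<lambda>x. f x * cnj (f x))"
    and nz: "f a \<noteq> 0"
  shows "(LINT x|lborel. f x * cnj (f x)) \<noteq> 0"
proof
  assume 0: "(LINT x|lborel. f x * cnj (f x)) = 0"
  have eq: "f x * cnj (f x) = of_real ((norm (f x))\<^sup>2)" for x
    by (simp add: complex_norm_square[symmetric])
  have "integrable lborel (\<lambda>x. Re (f x * cnj (f x)))" using int by (rule integrable_Re)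
  then have int': "integrable lborel (\<lambda>x. (norm (f x))\<^sup>2)" by (simp only: eq Re_complex_of_real)
  have "(LINT x|lborel. (norm (f x))\<^sup>2) = 0"
    using 0 unfolding eq by (simp only: integral_complex_of_real of_real_eq_0_iff)
  then have "AE x in lborel. (norm (f x))\<^sup>2 = 0"
    using integral_nonneg_eq_0_iff_AE[OF int'] by simp
  then have "AE x in lebesgue. (norm (f x))\<^sup>2 = 0" by (rule AE_completion)
  moreover define S where "S = {x. f x \<noteq> 0}"
  ultimately have AE: "AE x in lebesgue. x \<notin> S" by simp
  have S: "open S" unfolding S_def using cont by (intro open_Collect_neq) auto
  then have "S \<in> null_sets lebesgue" using AE by (subst AE_iff_null_sets) auto
  then have "negligible S" by (simp only: negligible_iff_null_sets)
  then show False using open_not_negligible[OF S] nz by (auto simp: S_def)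
qed

lemma hausdorff_zero_if_Lp_bounded:
  fixes \<Phi> :: "'a::euclidean_space \<Rightarrow> complex"
  assumes p: "0 < p" "p < 1" and \<Phi>: "\<Phi> \<in> L1_loc (- {0})"
    and bd: "\<And>f. f \<in> test_fun (- {0}) \<Longrightarrow> \<exists>A. \<forall>y. translate y f \<in> test_fun (- {0}) \<longrightarrow>
        Lp_norm p (hausdorff_op \<Phi> (translate y f)) \<le> ennreal A"
  shows "hausdorff_zero \<Phi>"
  unfolding hausdorff_zero_def
proof (intro ballI allI)
  fix F :: "'a \<Rightarrow> complex" and x0 :: 'a
  assume F: "F \<in> test_fun (- {0})"
  let ?n = "DIM('a)"
  have supp_sub: "z \<in> supp F" if "F z \<noteq> 0" for z
    using that closure_subset[of "{x. F x \<noteq> 0}"] by (auto simp: supp_def)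
  have F0: "F 0 = 0" using F supp_sub[of 0] by (auto simp: test_fun_def)
  show "hausdorff_op \<Phi> F x0 = 0"
  proof (cases "x0 = 0 \<or> F = (\<lambda>_. 0)")
    case True
    then show ?thesis using F0 by (auto simp: hausdorff_op_def)
  next
    case False
    then have x0: "x0 \<noteq> 0" by auto
    from False obtain x1 where x1: "F x1 \<noteq> 0" by auto
    have contF: "continuous_on UNIV F" using F by (rule continuous_on_test_fun)
    have mF[measurable]: "F \<in> borel_measurable borel" using contF by (rule borel_measurable_continuous_onI)
    have "bounded (supp F)" "closed (supp F)" "0 \<notin> supp F"
      using F by (auto simp: test_fun_def compact_imp_bounded compact_imp_closed)
    then obtain R r where R: "R > 0" "\<And>z. z \<in> supp F \<Longrightarrow> norm z \<le> R"
      and r: "r > 0" "\<And>z. z \<in> supp F \<Longrightarrow> r \<le> norm z"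
      by (metis bounded_pos dist_0_norm separate_point_closed)
    define f where "f = (\<lambda>x. F x * cnj (F x))"
    have f: "f \<in> test_fun (- {0})" unfolding f_def using F by (rule test_fun_mult_cnj)
    have fR: "norm w \<le> R" if "f w \<noteq> 0" for w using that R supp_sub by (auto simp: f_def)
    have suppf: "supp f = supp F" by (simp add: supp_def f_def)
    have int_f: "integrable lborel f" using f by (rule integrable_test_fun)
    have mf[measurable]: "f \<in> borel_measurable borel" using int_f by auto
    obtain B where B: "\<And>x. norm (f x) \<le> B" using test_fun_bounded[OF f] by blast
    obtain BF where BF: "\<And>x. norm (F x) \<le> BF" using test_fun_bounded[OF F] by blast
    have BF0: "0 \<le> BF" using BF[of 0] norm_ge_zero order_trans by blast
    obtain e :: 'a where "e \<in> Basis" using nonempty_Basis by blast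
    then have e: "norm e = 1" by simp
    define a b where "a = norm x0 / R" and "b = norm x0 / r"
    have ab: "0 < a" "0 < b" using x0 R r by (auto simp: a_def b_def)
    have ann: "a \<le> norm z \<and> norm z \<le> b" if "F (x0 /\<^sub>R norm z) \<noteq> 0" for z :: 'a
    proof -
      have "z \<noteq> 0" using that F0 by auto
      then show ?thesis using R r supp_sub[OF that]
        by (force simp: a_def b_def divide_simps mult.commute)
    qed
    define \<psi> where "\<psi> z = F (x0 /\<^sub>R norm z) / of_real (norm z ^ ?n)" for z :: 'a
    have m\<psi>: "\<psi> \<in> borel_measurable borel" unfolding \<psi>_def[abs_def] by measurable
    have \<psi>_bd: "norm (\<psi> z) \<le> BF / a ^ ?n" for z
    proof (cases "F (x0 /\<^sub>R norm z) = 0")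
      case False
      then have "a ^ ?n \<le> norm z ^ ?n" using ann ab by (intro power_mono) auto
      then show ?thesis using BF ab BF0
        by (auto simp: \<psi>_def norm_divide norm_power intro!: frac_le)
    qed (use BF0 ab in \<open>simp add: \<psi>_def\<close>)
    have \<psi>_cont: "isCont \<psi> (s *\<^sub>R e)" if "0 < s" for s
    proof -
      have "s *\<^sub>R e \<noteq> 0" using that e by auto
      moreover from this have "isCont (\<lambda>z. x0 /\<^sub>R norm z) (s *\<^sub>R e)"
        by (intro continuous_intros) auto
      then have "isCont (\<lambda>z. F (x0 /\<^sub>R norm z)) (s *\<^sub>R e)"
        by (rule isCont_o2) (use contF in \<open>simp add: continuous_on_eq_continuous_at\<close>)
      ultimately show ?thesis unfolding \<psi>_def[abs_def]
        by (intro continuous_divide continuous_of_real continuous_power continuous_norm continuous_ident) auto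
    qed
    have m\<Phi>: "\<Phi> \<in> borel_measurable lebesgue" using \<Phi> by (simp add: L1_loc_def)
    obtain \<Phi>' where \<Phi>'[measurable]: "\<Phi>' \<in> borel_measurable borel"
        and eq: "AE x in lebesgue. \<Phi> x = \<Phi>' x"
      using ex_borel_eq_AE_lebesgue[OF m\<Phi>] by blast
    have m\<Phi>': "\<Phi>' \<in> borel_measurable lebesgue" by (rule measurable_completion) simp
    note H_cong = hausdorff_op_cong_AE[OF m\<Phi> m\<Phi>' _ eq]
    define K where "K = cball (0::'a) (2 * b) - ball 0 (a / 2)"
    have K: "compact K" "K \<subseteq> - {0}" using ab by (auto simp: K_def intro: compact_diff)
    have mK[measurable]: "K \<in> sets borel" using K by (simp add: borel_compact)
    define \<Psi> where "\<Psi> y = indicator K y *\<^sub>R \<Phi>' y" for y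
    have m\<Psi>[measurable]: "\<Psi> \<in> borel_measurable borel" unfolding \<Psi>_def[abs_def] by measurable
    have "integrable lebesgue (\<lambda>y. indicator K y *\<^sub>R \<Phi> y)"
      using \<Phi> K by (simp add: L1_loc_def set_integrable_def)
    then have "integrable lebesgue \<Psi>"
      by (rule Bochner_Integration.integrable_cong_AE_imp)
        (use eq in \<open>auto simp: \<Psi>_def intro: measurable_completion elim: eventually_mono\<close>)
    then have int_\<Psi>: "integrable lborel \<Psi>" by (simp add: integrable_completion)
    have \<Psi>_supp: "y \<noteq> 0 \<and> norm y \<le> 2 * b" if "\<Psi> y \<noteq> 0" for y
      using that ab by (auto simp: \<Psi>_def K_def split: split_indicator_asm)
    obtain A where A: "\<And>y. translate y f \<in> test_fun (- {0}) \<Longrightarrow>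
        Lp_norm p (hausdorff_op \<Phi> (translate y f)) \<le> ennreal A"
      using bd[OF f] by blast
    have "(LINT y|lborel. \<Psi> y * of_real (norm y ^ ?n) * \<psi> (norm y *\<^sub>R e)) * (LINT w|lborel. f w) = 0"
    proof (rule hausdorff_limit_eq_zero[OF p int_\<Psi> \<Psi>_supp _ int_f B fR _ e m\<psi> \<psi>_bd \<psi>_cont])
      fix t assume t: "2 * R \<le> t"
      have t0: "0 < t" "R < t" using R t by linarith+
      have Tf: "translate (t *\<^sub>R e) f \<in> test_fun (- {0})"
      proof -
        have "0 \<notin> supp (translate (t *\<^sub>R e) f)"
        proof
          assume "0 \<in> supp (translate (t *\<^sub>R e) f)"
          then obtain z where "z \<in> supp F" "t *\<^sub>R e + z = 0" by (auto simp: supp_translate suppf)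
          then have "norm z = t" using e t0 by (metis add_eq_0_iff norm_minus_cancel norm_scaleR abs_of_pos mult_1_right)
          with R(2)[OF \<open>z \<in> supp F\<close>] t0 show False by simp
        qed
        moreover have "translate (t *\<^sub>R e) f \<in> test_fun UNIV"
          using f by (intro test_fun_translate) (auto simp: test_fun_def)
        ultimately show ?thesis by (auto simp: test_fun_def)
      qed
      have H_eq: "hausdorff_op \<Psi> (translate (t *\<^sub>R e) f) x = hausdorff_op \<Phi> (translate (t *\<^sub>R e) f) x"
        if "\<psi> (x /\<^sub>R t) \<noteq> 0" for x
      proof -
        have "norm (x /\<^sub>R t) \<le> b" "a \<le> norm (x /\<^sub>R t)"
          using that ann[of "x /\<^sub>R t"] by (auto simp: \<psi>_def)
        then have x: "norm x \<le> b * t" "a * t \<le> norm x"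
          using t0 by (auto simp: divide_simps mult.commute)
        have "\<Psi> y * translate (t *\<^sub>R e) f (x /\<^sub>R norm y) = \<Phi>' y * translate (t *\<^sub>R e) f (x /\<^sub>R norm y)" for y
        proof (cases "translate (t *\<^sub>R e) f (x /\<^sub>R norm y) = 0")
          case False
          then have *: "norm (x /\<^sub>R norm y - t *\<^sub>R e) \<le> R" using fR by (auto simp: translate_def)
          have y: "y \<noteq> 0" using * e t0 by auto
          have "norm (t *\<^sub>R e) = t" using e t0 by simp
          then have "norm (x /\<^sub>R norm y) \<le> t + R" "t - R \<le> norm (x /\<^sub>R norm y)"
            using * norm_triangle_sub[of "x /\<^sub>R norm y" "t *\<^sub>R e"]
              norm_triangle_sub[of "t *\<^sub>R e" "x /\<^sub>R norm y"] norm_minus_commute[of "t *\<^sub>R e" "x /\<^sub>R norm y"]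
            by linarith+
          then have "norm (x /\<^sub>R norm y) \<le> 2 * t" "t / 2 \<le> norm (x /\<^sub>R norm y)" using t t0 by linarith+
          then have "norm x \<le> 2 * t * norm y" "t / 2 * norm y \<le> norm x"
            using y by (auto simp: divide_simps mult.commute)
          with x have "a * t \<le> 2 * norm y * t" "norm y * t \<le> 2 * b * t" by (auto simp: mult_ac)
          then have "y \<in> K" using t0 by (auto simp: K_def)
          then show ?thesis by (simp add: \<Psi>_def)
        qed simp
        then have "hausdorff_op \<Psi> (translate (t *\<^sub>R e) f) x = hausdorff_op \<Phi>' (translate (t *\<^sub>R e) f) x"
          unfolding hausdorff_op_def by (simp only:)
        also have "\<dots> = hausdorff_op \<Phi> (translate (t *\<^sub>R e) f) x"
          by (rule H_cong[symmetric]) measurable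
        finally show ?thesis .
      qed
      have "(\<integral>\<^sup>+x. ennreal (norm (hausdorff_op \<Psi> (translate (t *\<^sub>R e) f) x) powr p) *
          indicator {x. \<psi> (x /\<^sub>R t) \<noteq> 0} x \<partial>lborel)
          \<le> (\<integral>\<^sup>+x. ennreal (norm (hausdorff_op \<Phi> (translate (t *\<^sub>R e) f) x) powr p) \<partial>lborel)"
        by (rule nn_integral_mono) (auto simp: H_eq split: split_indicator)
      also have "\<dots> \<le> ennreal (max 0 A powr p)"
        by (rule nn_integral_powr_le_of_Lp_norm_le[OF p(1) A[OF Tf]])
      finally show "(\<integral>\<^sup>+x. ennreal (norm (hausdorff_op \<Psi> (translate (t *\<^sub>R e) f) x) powr p) *
          indicator {x. \<psi> (x /\<^sub>R t) \<noteq> 0} x \<partial>lborel) \<le> ennreal (max 0 A powr p)" .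
    qed (use ab R in auto)
    moreover have "(LINT w|lborel. f w) \<noteq> 0"
      using integral_mult_cnj_nonzero[OF contF _ x1] int_f by (simp add: f_def)
    moreover have "\<Psi> y * of_real (norm y ^ ?n) * \<psi> (norm y *\<^sub>R e) = \<Phi>' y * F (x0 /\<^sub>R norm y)" for y
    proof (cases "F (x0 /\<^sub>R norm y) = 0")
      case False
      then have "y \<in> K" "y \<noteq> 0" using ann[OF False] ab by (auto simp: K_def)
      then show ?thesis using e by (simp add: \<Psi>_def \<psi>_def)
    qed (use e in \<open>simp add: \<psi>_def\<close>)
    ultimately have "(LINT y|lborel. \<Phi>' y * F (x0 /\<^sub>R norm y)) = 0" by simp
    then show ?thesis
      by (simp add: H_cong[OF mF] hausdorff_op_lborel)
  qed
qed

lemma hausdorff_bounded_on_if_zero: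
  fixes X :: "'a::euclidean_space fd_space"
  assumes X: "quasi_banach_space X" and zero: "hausdorff_zero \<Phi>"
  shows "hausdorff_bounded_on \<Phi> X"
proof -
  have "hausdorff_op \<Phi> f = (\<lambda>_. 0)" if "f \<in> test_fun (- {0})" for f
    using zero that by (auto simp: hausdorff_zero_def)
  moreover have "(\<lambda>_. 0) \<in> funs_of X \<and> fnorm X (\<lambda>_. 0) = 0"
  proof (cases X)
    case (Fun_Space Y N)
    with X show ?thesis by (auto simp: quasi_banach_def)
  next
    case (Dist_Space Y N)
    have "distribution_of (\<lambda>_. 0) = ((\<lambda>_. 0) :: ('a \<Rightarrow> complex) \<Rightarrow> complex)"
      by (auto simp: distribution_of_def)
    with X Dist_Space show ?thesis
      by (auto simp: quasi_banach_def L1_loc_def set_integrable_def)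
  qed
  ultimately show ?thesis
    unfolding hausdorff_bounded_on_def by (intro exI[of _ 0]) simp
qed

theorem theorem3p1:
  fixes p C :: real
    and \<Phi> :: "real ^ 'n \<Rightarrow> complex"
    and X :: "(real ^ 'n) fd_space"
  assumes "0 < p" and "p < 1"
    and "\<Phi> \<in> L1_loc (- {0})"
    and "quasi_banach_space X"
    and "translation_invariant X"
    and "test_fun UNIV \<subseteq> funs_of X"
    and "C > 0"
    and "\<forall>g\<in>funs_of X. Lp_norm p g \<le> ennreal (C * fnorm X g)"
  shows "hausdorff_bounded_on \<Phi> X \<longleftrightarrow> hausdorff_zero \<Phi>"
proof
  assume "hausdorff_bounded_on \<Phi> X"
  then obtain C' where C': "\<And>f. f \<in> test_fun (- {0}) \<Longrightarrow>
      hausdorff_op \<Phi> f \<in> funs_of X \<and> fnorm X (hausdorff_op \<Phi> f) \<le> C' * fnorm X f"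
    unfolding hausdorff_bounded_on_def by blast
  show "hausdorff_zero \<Phi>"
  proof (rule hausdorff_zero_if_Lp_bounded[OF assms(1-3)])
    fix f :: "real ^ 'n \<Rightarrow> complex" assume "f \<in> test_fun (- {0})"
    then have f: "f \<in> test_fun UNIV" by (auto simp: test_fun_def)
    have "Lp_norm p (hausdorff_op \<Phi> (translate y f)) \<le> ennreal (C * (C' * fnorm X f))"
      if "translate y f \<in> test_fun (- {0})" for y
    proof -
      have "Lp_norm p (hausdorff_op \<Phi> (translate y f)) \<le> ennreal (C * fnorm X (hausdorff_op \<Phi> (translate y f)))"
        using assms(8) C'[OF that] by blast
      also have "\<dots> \<le> ennreal (C * (C' * fnorm X (translate y f)))"
        using C'[OF that] assms(7) by (intro ennreal_leI mult_left_mono) auto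
      also have "fnorm X (translate y f) = fnorm X f"
        using assms(5,6) f by (intro fnorm_translate) auto
      finally show ?thesis .
    qed
    then show "\<exists>A. \<forall>y. translate y f \<in> test_fun (- {0}) \<longrightarrow>
        Lp_norm p (hausdorff_op \<Phi> (translate y f)) \<le> ennreal A" by blast
  qed
qed (rule hausdorff_bounded_on_if_zero[OF assms(4)])

end
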